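(* Let $\Gamma$ be an infinite finitely generated group and let $S\subseteq\Gamma$ be a finite symmetric generating set with $e\in S$. Suppose that $K_n<\Gamma$ $(n\in\mathbb N)$ are finite subgroups such that $$\min_{s\in S}|K_n\cap sK_ns^{-1}|\longrightarrow\infty\qquad(n\to\infty).$$ Then $\Gamma$ has fixed price one.
   Context: Symmetric means $S=S^{-1}$; $e$ is the identity. Cost. Let $(X,\mu)$ be a standard probability space and $\mathcal R$ a countable probability-measure-preserving (pmp) equivalence relation on $X$. A graphing of $\mathcal R$ is a countable family $\Phi=\{\varphi_i:A_i\to B_i\}_{i\in I}$ of measure-preserving Borel isomorphisms between Borel subsets of $X$ with $(x,\varphi_i(x))\in\mathcal R$ for all $i\in I$, $x\in A_i$. It defines a graph on $X$ by joining $x$ to $\varphi_i(x)$; $\Phi$ generates $\mathcal R$ if, on a conull subset of $X$, the connected components of this graph are precisely the $\mathcal R$-classes. Put $\operatorname{cost}(\Phi)=\sum_{i}\mu(A_i)$ and $\operatorname{cost}(\mathcal R)=\inf\{\operatorname{cost}(\Phi):\Phi \text{ is a graphing that generates }\mathcal R\}$. For an essentially free pmp action $\Gamma\curvearrowright(X,\mu)$ of a countable group, $\operatorname{cost}(\Gamma\curvearrowright X)$ is the cost of its orbit equivalence relation. A countable group has fixed price one if every essentially free pmp action of it (on a standard probability space) has cost $1$. *)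

theory Defs
  imports "HOL-Probability.Probability" "HOL-Algebra.Generated_Groups" "HOL-Algebra.Group_Action"
begin

definition standard_prob_space :: "'x measure \<Rightarrow> bool" where
  "standard_prob_space M \<longleftrightarrow> prob_space M \<and>
     (\<exists>T. topspace T = space M \<and> completely_metrizable_space T \<and> second_countable T \<and>
          sets M = sigma_sets (space M) {U. openin T U})"

text \<open>An action is a homomorphism into the group of bijections of \<^term>\<open>space M\<close>
  (library locale \<^locale>\<open>group_action\<close>).\<close>

definition pmp_action :: "('g, 'b) monoid_scheme \<Rightarrow> 'x measure \<Rightarrow> ('g \<Rightarrow> 'x \<Rightarrow> 'x) \<Rightarrow> bool" where
  "pmp_action G M \<alpha> \<longleftrightarrow> group_action G (space M) \<alpha> \<and>
     (\<forall>g\<in>carrier G. \<alpha> g \<in> measurable M M \<and> distr M M (\<alpha> g) = M)"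

definition essentially_free :: "('g, 'b) monoid_scheme \<Rightarrow> 'x measure \<Rightarrow> ('g \<Rightarrow> 'x \<Rightarrow> 'x) \<Rightarrow> bool" where
  "essentially_free G M \<alpha> \<longleftrightarrow> (AE x in M. stabilizer G \<alpha> x = {\<one>\<^bsub>G\<^esub>})"

definition orbit_relation :: "('g, 'b) monoid_scheme \<Rightarrow> 'x measure \<Rightarrow> ('g \<Rightarrow> 'x \<Rightarrow> 'x) \<Rightarrow> ('x \<times> 'x) set" where
  "orbit_relation G M \<alpha> = {(x, y). x \<in> space M \<and> y \<in> Group_Action.orbit G \<alpha> x}"

definition partial_iso :: "'x measure \<Rightarrow> 'x set \<Rightarrow> 'x set \<Rightarrow> ('x \<Rightarrow> 'x) \<Rightarrow> bool" where
  "partial_iso M A B f \<longleftrightarrow> A \<in> sets M \<and> B \<in> sets M \<and> bij_betw f A B \<and>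
     f \<in> measurable (restrict_space M A) (restrict_space M B) \<and>
     the_inv_into A f \<in> measurable (restrict_space M B) (restrict_space M A) \<and>
     distr (restrict_space M A) (restrict_space M B) f = restrict_space M B"

text \<open>A countable family of partial maps is indexed by a set \<open>I\<close> of natural numbers, which may be
  finite or infinite; the values of \<open>A\<close>, \<open>B\<close>, \<open>f\<close> off \<open>I\<close>, and of \<open>f i\<close> off \<open>A i\<close>, are irrelevant.\<close>

definition graphing ::
  "'x measure \<Rightarrow> ('x \<times> 'x) set \<Rightarrow> nat set \<Rightarrow> (nat \<Rightarrow> 'x set) \<Rightarrow> (nat \<Rightarrow> 'x set) \<Rightarrow> (nat \<Rightarrow> 'x \<Rightarrow> 'x) \<Rightarrow> bool"
  where
  "graphing M R I A B f \<longleftrightarrow>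
     (\<forall>i\<in>I. partial_iso M (A i) (B i) (f i) \<and> (\<forall>x\<in>A i. (x, f i x) \<in> R))"

definition graphing_edges :: "nat set \<Rightarrow> (nat \<Rightarrow> 'x set) \<Rightarrow> (nat \<Rightarrow> 'x \<Rightarrow> 'x) \<Rightarrow> ('x \<times> 'x) set" where
  "graphing_edges I A f = (\<Union>i\<in>I. {(x, f i x) | x. x \<in> A i})"

definition graph_component :: "('x \<times> 'x) set \<Rightarrow> 'x \<Rightarrow> 'x set" where
  "graph_component E x = {y. (x, y) \<in> (E \<union> E\<inverse>)\<^sup>*}"

definition generates ::
  "'x measure \<Rightarrow> ('x \<times> 'x) set \<Rightarrow> nat set \<Rightarrow> (nat \<Rightarrow> 'x set) \<Rightarrow> (nat \<Rightarrow> 'x \<Rightarrow> 'x) \<Rightarrow> bool" where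
  "generates M R I A f \<longleftrightarrow> (AE x in M. graph_component (graphing_edges I A f) x = R `` {x})"

definition graphing_cost :: "'x measure \<Rightarrow> nat set \<Rightarrow> (nat \<Rightarrow> 'x set) \<Rightarrow> ennreal" where
  "graphing_cost M I A = (\<Sum>\<^sub>\<infinity>i\<in>I. emeasure M (A i))"

definition cost :: "'x measure \<Rightarrow> ('x \<times> 'x) set \<Rightarrow> ennreal" where
  "cost M R = Inf {graphing_cost M I A | I A B f. graphing M R I A B f \<and> generates M R I A f}"

text \<open>A definition cannot quantify over types, so the type of points of the probability spaces is a
  parameter, passed as \<^typ>\<open>'x itself\<close>; statements about fixed price one should be polymorphic
  in \<^typ>\<open>'x\<close>. The instance at the type of real numbers already covers all actions, since every
  standard Borel space is Borel isomorphic to a Borel subset of the real line.\<close>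

definition fixed_price_one :: "'x itself \<Rightarrow> ('g, 'b) monoid_scheme \<Rightarrow> bool" where
  "fixed_price_one _ G \<longleftrightarrow> group G \<and> countable (carrier G) \<and>
     (\<forall>(M :: 'x measure) \<alpha>.
        standard_prob_space M \<and> pmp_action G M \<alpha> \<and> essentially_free G M \<alpha> \<longrightarrow>
        cost M (orbit_relation G M \<alpha>) = 1)"

end

theory Submission
  imports Defs
begin

text \<open>
  Both inequalities rest on one fact. A finite subgroup \<open>H\<close> acting essentially freely on a standard
  probability space has a Borel set \<open>Y\<close> that meets every \<open>H\<close>-orbit and has measure at most
  \<open>1 / |H|\<close> (\<open>finite_subgroup_small_section\<close>): inject the space into the line by a Borel map and take
  the points that are smallest in their finite \<open>H\<close>-orbit.

  Cost at most one. Fix a finite subgroup \<open>K\<close>, and for \<open>s \<in> S\<close> let \<open>H\<^sub>s\<close> be the intersection of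
  \<open>K\<close> with \<open>s K s\<^sup>-\<^sup>1\<close>. Joining each point of a small section of \<open>K\<close> to its translates by \<open>K\<close>
  connects all \<open>K\<close>-orbits at cost at most \<open>1\<close>. Once this is done, the whole map \<open>s\<^sup>-\<^sup>1\<close> comes from its
  restriction to a small section of \<open>H\<^sub>s\<close>: for \<open>h \<in> H\<^sub>s\<close> we have \<open>s\<^sup>-\<^sup>1 h x = (s\<^sup>-\<^sup>1 h s) s\<^sup>-\<^sup>1 x\<close> with
  \<open>s\<^sup>-\<^sup>1 h s \<in> K\<close>, so \<open>x\<close> and \<open>s\<^sup>-\<^sup>1 x\<close> are joined through \<open>h x\<close> and \<open>s\<^sup>-\<^sup>1 h x\<close>. This costs at most
  \<open>1 / |H\<^sub>s|\<close> more for each \<open>s\<close> (\<open>cost_le_of_large_conjugate_intersections\<close>), and these terms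
  tend to \<open>0\<close> along \<open>K = K\<^sub>n\<close>.

  Cost at least one. Let \<open>Y\<close> be a set that meets almost every orbit. In the graph of a generating
  graphing, each point outside \<open>Y\<close> has an edge that leads one step closer to \<open>Y\<close>, and different
  points have different edges. Hence \<open>1\<close> is at most the measure of \<open>Y\<close> plus the cost
  (\<open>one_le_measure_plus_graphing_cost\<close>). Small sections of the subgroups \<open>K\<^sub>n\<close>, whose orders are
  unbounded, make the measure of \<open>Y\<close> arbitrarily small.
\<close>

section \<open>Small sections for finite subgroups\<close>

text \<open>In base \<open>3\<close> with digits \<open>0\<close> and \<open>1\<close>, the first differing digit, of weight \<open>3\<^sup>-\<^sup>k\<close>, outweighs all
  later ones, which contribute at most half of that. In base \<open>2\<close> the two sides can be equal.\<close>

lemma ternary_expansion_inj: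
  fixes a b :: "nat \<Rightarrow> bool"
  assumes "(\<Sum>i. of_bool (a i) / 3 ^ i :: real) = (\<Sum>i. of_bool (b i) / 3 ^ i)"
  shows "a = b"
proof (rule ccontr)
  assume "a \<noteq> b"
  define k where "k = (LEAST i. a i \<noteq> b i)"
  have "\<exists>i. a i \<noteq> b i" using \<open>a \<noteq> b\<close> by blast
  then have k: "a k \<noteq> b k" unfolding k_def by (rule LeastI_ex)
  have less: "a i = b i" if "i < k" for i
    using not_less_Least[of i "\<lambda>i. a i \<noteq> b i"] that unfolding k_def by blast
  define d :: "nat \<Rightarrow> real" where "d i = (of_bool (a i) - of_bool (b i)) / 3 ^ i" for i
  have geo: "summable (\<lambda>i. (1/3::real) ^ i)" by simp
  have sm: "summable (\<lambda>i. of_bool (c i) / 3 ^ i :: real)" for c :: "nat \<Rightarrow> bool"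
    by (rule summable_comparison_test'[OF geo, of 0]) (auto simp: power_divide)
  have d_bound: "\<bar>d i\<bar> \<le> (1/3) ^ i" for i
    by (auto simp: d_def power_divide)
  have "d sums 0"
    using sums_diff[OF summable_sums[OF sm[of a]] summable_sums[OF sm[of b]]] assms
    by (simp add: d_def[abs_def] diff_divide_distrib)
  then have "(\<lambda>i. d (i + Suc k)) sums (0 - (\<Sum>i<Suc k. d i))"
    by (rule sums_split_initial_segment)
  moreover have "(\<Sum>i<Suc k. d i) = d k"
    by (simp add: d_def less)
  ultimately have tail: "(\<lambda>i. d (i + Suc k)) sums (- d k)" by simp
  have "(\<lambda>i. (1/3::real) ^ i) sums (3/2)"
    using geometric_sums[of "1/3::real"] by simp
  then have geo': "(\<lambda>i. (1/3::real) ^ (i + Suc k)) sums ((1/3) ^ Suc k * (3/2))"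
    unfolding power_add by (subst mult.commute) (rule sums_mult)
  have "\<bar>d k\<bar> \<le> (1/3) ^ Suc k * (3/2)"
  proof -
    have "- d k \<le> (1/3) ^ Suc k * (3/2)"
      by (rule sums_le[OF abs_le_D1[OF d_bound] tail geo'])
    moreover have "d k \<le> (1/3) ^ Suc k * (3/2)"
      using sums_le[OF abs_le_D2[OF d_bound] sums_minus[OF tail] geo'] by simp
    ultimately show ?thesis by simp
  qed
  moreover have "\<bar>d k\<bar> = (1/3) ^ k"
    using k by (auto simp: d_def power_divide)
  ultimately show False by simp
qed

text \<open>A countable base of a \<open>T\<^sub>1\<close> topology separates points, so a point is determined by the sequence
  of its memberships in basic open sets.\<close>

lemma standard_prob_space_borel_injection:
  fixes M :: "'x measure"
  assumes "standard_prob_space M"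
  shows "\<exists>\<psi> :: 'x \<Rightarrow> real. \<psi> \<in> borel_measurable M \<and> inj_on \<psi> (space M)"
proof -
  obtain T where T: "topspace T = space M" "completely_metrizable_space T" "second_countable T"
      "sets M = sigma_sets (space M) {U. openin T U}"
    using assms unfolding standard_prob_space_def by blast
  obtain \<B> where \<B>: "countable \<B>" "\<And>V. V \<in> \<B> \<Longrightarrow> openin T V"
      "\<And>U x. openin T U \<Longrightarrow> x \<in> U \<Longrightarrow> \<exists>V \<in> \<B>. x \<in> V \<and> V \<subseteq> U"
    using T(3) unfolding second_countable_def by metis
  have t1: "t1_space T"
    using T(2) completely_metrizable_imp_metrizable_space metrizable_imp_t1_space by blast
  \<comment> \<open>The empty set is inserted so that there is something to enumerate; it adds only digits \<open>0\<close>.\<close>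
  define B where "B = from_nat_into (insert {} \<B>)"
  have rangeB: "range B = insert {} \<B>"
    unfolding B_def using \<B>(1) by (intro range_from_nat_into) auto
  have meas: "B i \<in> sets M" for i
  proof -
    have "B i \<in> insert {} \<B>" using rangeB by blast
    then have "openin T (B i)" using \<B>(2) by auto
    then show ?thesis using T(4) by auto
  qed
  define \<psi> :: "'x \<Rightarrow> real" where "\<psi> x = (\<Sum>i. of_bool (x \<in> B i) / 3 ^ i)" for x
  show ?thesis
  proof (intro exI conjI)
    have [measurable]: "Measurable.pred M (\<lambda>x. x \<in> B i)" for i
      using meas by simp
    have "of_bool (x \<in> B i) = (if x \<in> B i then 1 else (0::real))" for x i by simp
    then show "\<psi> \<in> borel_measurable M"
      unfolding \<psi>_def[abs_def] by (simp only:) measurable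
    show "inj_on \<psi> (space M)"
    proof (rule inj_onI, rule ccontr)
      fix x y assume xy: "x \<in> space M" "y \<in> space M" "\<psi> x = \<psi> y" "x \<noteq> y"
      then obtain U where "openin T U" "x \<in> U" "y \<notin> U"
        using t1 T(1) unfolding t1_space_def by blast
      then obtain V where V: "V \<in> \<B>" "x \<in> V" "y \<notin> V" using \<B>(3) by blast
      then obtain i where "V = B i" using rangeB by (metis insertI2 rangeE)
      moreover have "(\<lambda>i. x \<in> B i) = (\<lambda>i. y \<in> B i)"
        using xy(3) unfolding \<psi>_def by (rule ternary_expansion_inj)
      ultimately show False using V by meson
    qed
  qed
qed

lemma pmp_action_facts:
  assumes "pmp_action G M \<alpha>" "g \<in> carrier G"
  shows "\<alpha> g \<in> measurable M M" "distr M M (\<alpha> g) = M"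
    "x \<in> space M \<Longrightarrow> \<alpha> g x \<in> space M"
    "x \<in> space M \<Longrightarrow> \<alpha> (inv\<^bsub>G\<^esub> g) (\<alpha> g x) = x"
    "x \<in> space M \<Longrightarrow> h \<in> carrier G \<Longrightarrow> \<alpha> (h \<otimes>\<^bsub>G\<^esub> g) x = \<alpha> h (\<alpha> g x)"
    "x \<in> space M \<Longrightarrow> \<alpha> \<one>\<^bsub>G\<^esub> x = x"
    "group G"
proof -
  interpret group_action G "space M" \<alpha>
    using assms by (simp add: pmp_action_def)
  show "\<alpha> g \<in> measurable M M" "distr M M (\<alpha> g) = M"
    using assms by (auto simp: pmp_action_def)
  show "x \<in> space M \<Longrightarrow> \<alpha> g x \<in> space M"
    using element_image assms by blast
  show "x \<in> space M \<Longrightarrow> \<alpha> (inv\<^bsub>G\<^esub> g) (\<alpha> g x) = x"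
    using orbit_sym_aux assms by blast
  show "x \<in> space M \<Longrightarrow> h \<in> carrier G \<Longrightarrow> \<alpha> (h \<otimes>\<^bsub>G\<^esub> g) x = \<alpha> h (\<alpha> g x)"
    using composition_rule assms by blast
  show "x \<in> space M \<Longrightarrow> \<alpha> \<one>\<^bsub>G\<^esub> x = x"
    by (metis id_eq_one restrict_apply')
  show "group G"
    using group_hom group_hom.axioms(1) by blast
qed

text \<open>The section consists of the points minimising \<open>\<psi>\<close> on their \<open>H\<close>-orbit. If the stabilizer of
  \<open>x\<close> is trivial, the minimum over the orbit of \<open>x\<close> is attained at \<open>h x\<close> for only one \<open>h \<in> H\<close>.
  Integrating the number of \<open>h \<in> H\<close> with \<open>h x \<in> Y\<close> over \<open>x\<close> gives the bound on the measure.\<close>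

lemma finite_subgroup_small_section:
  assumes std: "standard_prob_space M" and act: "pmp_action G M \<alpha>"
    and free: "essentially_free G M \<alpha>" and H: "subgroup H G" "finite H"
  obtains Y where "Y \<in> sets M" "\<And>x. x \<in> space M \<Longrightarrow> \<exists>h\<in>H. \<alpha> h x \<in> Y"
    "of_nat (card H) * emeasure M Y \<le> 1"
proof -
  interpret prob_space M using std by (simp add: standard_prob_space_def)
  note act_simps = pmp_action_facts[OF act]
  have Hc: "h \<in> carrier G" if "h \<in> H" for h using H(1) that by (rule subgroup.mem_carrier)
  have "H \<noteq> {}" using subgroup.one_closed[OF H(1)] by blast
  interpret group G using act_simps(7)[OF Hc[OF subgroup.one_closed[OF H(1)]]] .
  obtain \<psi> :: "_ \<Rightarrow> real" where \<psi>[measurable]: "\<psi> \<in> borel_measurable M" and inj: "inj_on \<psi> (space M)"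
    using standard_prob_space_borel_injection[OF std] by blast
  have [measurable]: "\<alpha> h \<in> measurable M M" if "h \<in> H" for h
    using act_simps(1) Hc that by blast
  define Y where "Y = {x \<in> space M. \<forall>h\<in>H. \<psi> x \<le> \<psi> (\<alpha> h x)}"
  show thesis
  proof
    show Y[measurable]: "Y \<in> sets M"
    proof -
      have "Measurable.pred M (\<lambda>x. \<forall>h\<in>H. \<psi> x \<le> \<psi> (\<alpha> h x))"
        using H(2) by (intro pred_intros_finite) measurable
      then show ?thesis unfolding Y_def by simp
    qed
    show "\<exists>h\<in>H. \<alpha> h x \<in> Y" if x: "x \<in> space M" for x
    proof -
      define h where "h = arg_min_on (\<lambda>h. \<psi> (\<alpha> h x)) H"
      have h: "h \<in> H"
        unfolding h_def using H(2) \<open>H \<noteq> {}\<close> by (rule arg_min_if_finite(1))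
      have h_min: "\<psi> (\<alpha> h x) \<le> \<psi> (\<alpha> k x)" if "k \<in> H" for k
        unfolding h_def using H(2) \<open>H \<noteq> {}\<close> that by (rule arg_min_least)
      have "\<psi> (\<alpha> h x) \<le> \<psi> (\<alpha> k (\<alpha> h x))" if k: "k \<in> H" for k
        using h_min[OF subgroup.m_closed[OF H(1) k h]] act_simps(5)[OF Hc[OF h] x Hc[OF k]] by simp
      moreover have "\<alpha> h x \<in> space M" using act_simps(3)[OF Hc[OF h] x] .
      ultimately have "\<alpha> h x \<in> Y" unfolding Y_def by blast
      then show ?thesis using h by blast
    qed
    have count: "AE x in M. (\<Sum>h\<in>H. indicator Y (\<alpha> h x) :: ennreal) \<le> 1"
      using free[unfolded essentially_free_def]
    proof (rule AE_mp, intro AE_I2 impI)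
      fix x assume x: "x \<in> space M" and stab: "stabilizer G \<alpha> x = {\<one>\<^bsub>G\<^esub>}"
      have eq: "h = k" if hk: "h \<in> H" "k \<in> H" "\<alpha> h x \<in> Y" "\<alpha> k x \<in> Y" for h k
      proof -
        have *: "\<psi> (\<alpha> h x) \<le> \<psi> (\<alpha> k x)" if "h \<in> H" "k \<in> H" "\<alpha> h x \<in> Y" for h k
        proof -
          have "k \<otimes>\<^bsub>G\<^esub> inv\<^bsub>G\<^esub> h \<in> H"
            using H(1) that by (simp add: subgroup.m_closed subgroup.m_inv_closed)
          then have "\<psi> (\<alpha> h x) \<le> \<psi> (\<alpha> (k \<otimes>\<^bsub>G\<^esub> inv\<^bsub>G\<^esub> h) (\<alpha> h x))"
            using that(3) unfolding Y_def by blast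
          also have "\<alpha> (k \<otimes>\<^bsub>G\<^esub> inv\<^bsub>G\<^esub> h) (\<alpha> h x) = \<alpha> k x"
            using that Hc x by (simp add: act_simps(3,4,5))
          finally show ?thesis .
        qed
        have "\<psi> (\<alpha> h x) = \<psi> (\<alpha> k x)" using *[of h k] *[of k h] hk by auto
        then have "\<alpha> h x = \<alpha> k x"
          using inj hk x Hc act_simps(3) by (metis inj_on_eq_iff)
        then have "\<alpha> (inv\<^bsub>G\<^esub> k \<otimes>\<^bsub>G\<^esub> h) x = x"
          using hk Hc x by (simp add: act_simps(3,4,5))
        then have "inv\<^bsub>G\<^esub> k \<otimes>\<^bsub>G\<^esub> h \<in> stabilizer G \<alpha> x"
          using hk Hc by (simp add: stabilizer_def)
        then have "inv\<^bsub>G\<^esub> k \<otimes>\<^bsub>G\<^esub> h = \<one>\<^bsub>G\<^esub>" using stab by simp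
        then show "h = k" using hk Hc by (metis inv_closed inv_equality inv_inv)
      qed
      show "(\<Sum>h\<in>H. indicator Y (\<alpha> h x) :: ennreal) \<le> 1"
      proof (cases "\<exists>h\<in>H. \<alpha> h x \<in> Y")
        case True
        then obtain h where h: "h \<in> H" "\<alpha> h x \<in> Y" by blast
        have "\<alpha> k x \<in> Y \<longleftrightarrow> k = h" if "k \<in> H" for k
          using eq[OF that h(1) _ h(2)] h(2) by blast
        then have "(\<Sum>k\<in>H. indicator Y (\<alpha> k x) :: ennreal) = (\<Sum>k\<in>H. if k = h then 1 else 0)"
          by (intro sum.cong) (simp_all add: indicator_def)
        also have "\<dots> = 1" using h H(2) by simp
        finally show ?thesis by simp
      next
        case False
        then show ?thesis by simp
      qed
    qed
    have "of_nat (card H) * emeasure M Y = (\<Sum>h\<in>H. emeasure M Y)" by simp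
    also have "\<dots> = (\<Sum>h\<in>H. \<integral>\<^sup>+x. indicator Y (\<alpha> h x) \<partial>M)"
    proof (rule sum.cong)
      fix h assume "h \<in> H"
      then have h: "h \<in> carrier G" by (rule Hc)
      have "emeasure M Y = (\<integral>\<^sup>+x. indicator Y x \<partial>distr M M (\<alpha> h))"
        using act_simps(2)[OF h] by simp
      also have "\<dots> = (\<integral>\<^sup>+x. indicator Y (\<alpha> h x) \<partial>M)"
        using act_simps(1)[OF h] by (intro nn_integral_distr) auto
      finally show "emeasure M Y = (\<integral>\<^sup>+x. indicator Y (\<alpha> h x) \<partial>M)" .
    qed simp
    also have "\<dots> = (\<integral>\<^sup>+x. (\<Sum>h\<in>H. indicator Y (\<alpha> h x)) \<partial>M)"
      by (rule nn_integral_sum[symmetric]) measurable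
    also have "\<dots> \<le> (\<integral>\<^sup>+x. 1 \<partial>M)"
      using count by (rule nn_integral_mono_AE)
    also have "\<dots> = 1" by (simp add: emeasure_space_1)
    finally show "of_nat (card H) * emeasure M Y \<le> 1" .
  qed
qed

section \<open>A lower bound for the cost of a graphing\<close>

lemma partial_iso_image:
  assumes "partial_iso M A B f" "N \<in> sets M" "N \<subseteq> A"
  shows "f ` N \<in> sets M" "emeasure M (f ` N) = emeasure M N"
proof -
  have A: "A \<in> sets M" and B: "B \<in> sets M" and bij: "bij_betw f A B"
    and f: "f \<in> measurable (restrict_space M A) (restrict_space M B)"
    and g: "the_inv_into A f \<in> measurable (restrict_space M B) (restrict_space M A)"
    and d: "distr (restrict_space M A) (restrict_space M B) f = restrict_space M B"
    using assms(1) by (auto simp: partial_iso_def)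
  have sp: "space (restrict_space M C) = C" if "C \<in> sets M" for C
    using sets.sets_into_space[OF that] by (auto simp: space_restrict_space)
  have inj: "inj_on f A" and im: "f ` A = B" using bij by (auto simp: bij_betw_def)
  have eq: "the_inv_into A f -` N \<inter> space (restrict_space M B) = f ` N"
    using assms(3) im the_inv_into_f_f[OF inj] by (auto simp: sp[OF B] intro!: image_eqI)
  have NA: "N \<in> sets (restrict_space M A)"
    using assms A by (simp add: sets_restrict_space_iff)
  then have fN: "f ` N \<in> sets (restrict_space M B)"
    using measurable_sets[OF g, of N] eq by simp
  then show "f ` N \<in> sets M" using B by (simp add: sets_restrict_space_iff)
  have "emeasure M (f ` N) = emeasure (restrict_space M B) (f ` N)"
    using assms(3) im B by (subst emeasure_restrict_space) auto
  also have "\<dots> = emeasure (restrict_space M A) (f -` (f ` N) \<inter> space (restrict_space M A))"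
    by (subst d[symmetric], rule emeasure_distr[OF f fN])
  also have "f -` (f ` N) \<inter> space (restrict_space M A) = N"
    using assms(3) inj by (auto simp: sp[OF A] inj_on_def)
  also have "emeasure (restrict_space M A) N = emeasure M N"
    using assms(3) A by (subst emeasure_restrict_space) auto
  finally show "emeasure M (f ` N) = emeasure M N" .
qed

primrec graph_ball :: "('x \<times> 'x) set \<Rightarrow> 'x set \<Rightarrow> nat \<Rightarrow> 'x set" where
  "graph_ball E Y 0 = Y"
| "graph_ball E Y (Suc n) = graph_ball E Y n \<union> (E \<union> E\<inverse>) `` graph_ball E Y n"

lemma graph_ball_mono: "m \<le> n \<Longrightarrow> graph_ball E Y m \<subseteq> graph_ball E Y n"
  by (rule lift_Suc_mono_le[of "graph_ball E Y"]) auto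

lemma connected_imp_graph_ball:
  assumes "(x, y) \<in> (E \<union> E\<inverse>)\<^sup>*" "y \<in> Y"
  shows "\<exists>n. x \<in> graph_ball E Y n"
  using assms(1)
proof (induction rule: converse_rtrancl_induct)
  case base
  then show ?case using assms(2) by (intro exI[of _ 0]) simp
next
  case (step x z)
  then obtain n where "z \<in> graph_ball E Y n" by blast
  then have "x \<in> graph_ball E Y (Suc n)" using step(1) by auto
  then show ?case by blast
qed

lemma graphing_cost_eq_suminf:
  "graphing_cost M I A = (\<Sum>i. if i \<in> I then emeasure M (A i) else 0)"
proof -
  let ?a = "\<lambda>i. if i \<in> I then emeasure M (A i) else 0"
  have "graphing_cost M I A = infsum ?a UNIV"
    unfolding graphing_cost_def by (rule infsum_cong_neutral) auto
  moreover have "?a summable_on UNIV"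
    by (rule nonneg_summable_on_complete) simp
  ultimately show ?thesis
    using has_sum_imp_sums has_sum_infsum sums_unique by metis
qed

text \<open>Let every point outside \<open>Y\<close> choose an edge that decreases its graph distance to \<open>Y\<close>. An edge is chosen by
  its farther endpoint only, so on the domain of each partial map the points whose edge leads closer
  to \<open>Y\<close> and those whose edge is used backwards are disjoint. The former, together with the images
  of the latter, cover the complement of \<open>Y\<close>.\<close>

lemma one_le_measure_plus_graphing_cost:
  assumes "prob_space M" and gr: "graphing M R I A B f" and gen: "generates M R I A f"
    and Y: "Y \<in> sets M" and meets: "AE x in M. R `` {x} \<inter> Y \<noteq> {}"
  shows "1 \<le> emeasure M Y + graphing_cost M I A"
proof -
  interpret prob_space M by fact
  define E where "E = graphing_edges I A f"
  define D where "D = graph_ball E Y"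
  have iso: "partial_iso M (A i) (B i) (f i)" if "i \<in> I" for i
    using gr that by (auto simp: graphing_def)
  have A: "A i \<in> sets M" if "i \<in> I" for i
    using iso[OF that] by (auto simp: partial_iso_def)
  have img: "f i ` N \<in> sets M" if "i \<in> I" "N \<in> sets M" "N \<subseteq> A i" for i N
    using partial_iso_image(1)[OF iso] that by blast
  have pre: "{x \<in> A i. f i x \<in> N} \<in> sets M" if "i \<in> I" "N \<in> sets M" for i N
  proof -
    have B: "B i \<in> sets M" and bij: "bij_betw (f i) (A i) (B i)" and
      m: "f i \<in> measurable (restrict_space M (A i)) (restrict_space M (B i))"
      using iso[OF that(1)] by (auto simp: partial_iso_def)
    have "N \<inter> B i \<in> sets (restrict_space M (B i))"
      using that B by (simp add: sets_restrict_space_iff)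
    from measurable_sets[OF m this]
    have "f i -` (N \<inter> B i) \<inter> space (restrict_space M (A i)) \<in> sets M"
      using A[OF that(1)] by (simp add: sets_restrict_space_iff)
    also have "f i -` (N \<inter> B i) \<inter> space (restrict_space M (A i)) = {x \<in> A i. f i x \<in> N}"
      using bij sets.sets_into_space[OF A[OF that(1)]]
      by (auto simp: space_restrict_space bij_betw_def)
    finally show ?thesis .
  qed
  have D: "D n \<in> sets M" for n
  proof (induction n)
    case 0
    then show ?case using Y by (simp add: D_def)
  next
    case (Suc n)
    have "D (Suc n) = D n \<union> (\<Union>i\<in>I. f i ` (A i \<inter> D n)) \<union> (\<Union>i\<in>I. {x \<in> A i. f i x \<in> D n})"
    proof -
      have "(E \<union> E\<inverse>) `` V = (\<Union>i\<in>I. f i ` (A i \<inter> V)) \<union> (\<Union>i\<in>I. {x \<in> A i. f i x \<in> V})" for V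
        by (auto simp: E_def graphing_edges_def Image_iff) blast
      then show ?thesis by (simp add: D_def Un_assoc)
    qed
    also have "\<dots> \<in> sets M"
      using Suc A img pre by (intro sets.Un sets.countable_UN'') auto
    finally show ?case .
  qed
  have D_mono: "m \<le> n \<Longrightarrow> D m \<subseteq> D n" for m n
    unfolding D_def by (rule graph_ball_mono)
  \<comment> \<open>\<open>P i\<close>: the edge from \<open>x\<close> to \<open>f i x\<close> approaches \<open>Y\<close>; \<open>N i\<close>: it moves away from \<open>Y\<close>.\<close>
  define P where "P i = (\<Union>n. {x \<in> A i. f i x \<in> D n} - D n)" for i
  define N where "N i = (\<Union>n. (A i \<inter> D n) - {x \<in> A i. f i x \<in> D n})" for i
  have PN: "P i \<in> sets M" "N i \<in> sets M" "P i \<subseteq> A i" "N i \<subseteq> A i" if "i \<in> I" for i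
    using A[OF that] D pre[OF that] by (auto simp: P_def N_def)
  have disj: "P i \<inter> N i = {}" for i
  proof (rule ccontr)
    assume "P i \<inter> N i \<noteq> {}"
    then obtain x m n where "f i x \<in> D m" "x \<notin> D m" "x \<in> D n" "f i x \<notin> D n"
      by (auto simp: P_def N_def)
    then show False using D_mono[of m n] D_mono[of n m] by (cases "m \<le> n") auto
  qed
  define C where "C i = (if i \<in> I then P i \<union> f i ` N i else {})" for i
  have C: "range C \<subseteq> sets M"
    using PN img by (auto simp: C_def)
  have "AE x in M. x \<in> Y \<union> (\<Union>i. C i)"
    using gen[unfolded generates_def] meets
  proof eventually_elim
    case (elim x)
    then obtain y where "y \<in> Y" "(x, y) \<in> (E \<union> E\<inverse>)\<^sup>*"
      by (auto simp: graph_component_def E_def)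
    then have ex: "\<exists>n. x \<in> D n" unfolding D_def by (intro connected_imp_graph_ball)
    show ?case
    proof (cases "x \<in> Y")
      case False
      define n where "n = (LEAST n. x \<in> D n)"
      have n: "x \<in> D n" unfolding n_def using ex by (rule LeastI_ex)
      have "n \<noteq> 0" using n False by (cases n) (auto simp: D_def)
      then obtain m where m: "n = Suc m" by (cases n) auto
      have nm: "x \<notin> D m" using not_less_Least[of m "\<lambda>n. x \<in> D n"] m n_def by simp
      then obtain y where "y \<in> D m" "(x, y) \<in> E \<union> E\<inverse>"
        using n m by (auto simp: D_def)
      then consider i where "i \<in> I" "x \<in> A i" "f i x \<in> D m"
        | i where "i \<in> I" "y \<in> A i" "y \<in> D m" "x = f i y"
        by (auto simp: E_def graphing_edges_def)
      then have "\<exists>i. x \<in> C i"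
      proof cases
        case 1
        then have "x \<in> P i" using nm by (auto simp: P_def)
        then show ?thesis using 1 by (auto simp: C_def)
      next
        case 2
        then have "y \<in> N i" using nm by (auto simp: N_def)
        then show ?thesis using 2 by (intro exI[of _ i]) (auto simp: C_def)
      qed
      then show ?thesis by blast
    qed auto
  qed
  then have "emeasure M (space M) \<le> emeasure M (Y \<union> (\<Union>i. C i))"
    using Y C by (intro emeasure_mono_AE) auto
  also have "\<dots> \<le> emeasure M Y + emeasure M (\<Union>i. C i)"
    using Y C by (intro emeasure_subadditive) auto
  also have "emeasure M (\<Union>i. C i) \<le> (\<Sum>i. emeasure M (C i))"
    by (rule emeasure_subadditive_countably[OF C])
  also have "(\<Sum>i. emeasure M (C i)) \<le> graphing_cost M I A"
    unfolding graphing_cost_eq_suminf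
  proof (rule suminf_le)
    fix i
    show "emeasure M (C i) \<le> (if i \<in> I then emeasure M (A i) else 0)"
    proof (cases "i \<in> I")
      case True
      have "emeasure M (C i) \<le> emeasure M (P i) + emeasure M (f i ` N i)"
        using True PN img by (auto simp: C_def intro!: emeasure_subadditive)
      also have "\<dots> = emeasure M (P i) + emeasure M (N i)"
        using partial_iso_image(2)[OF iso] True PN by simp
      also have "\<dots> = emeasure M (P i \<union> N i)"
        using True PN disj by (intro plus_emeasure) auto
      also have "\<dots> \<le> emeasure M (A i)"
        using True PN A by (intro emeasure_mono) auto
      finally show ?thesis using True by simp
    qed (simp add: C_def)
  qed auto
  finally show ?thesis by (simp add: emeasure_space_1 add_left_mono)
qed

section \<open>Graphings made of group elements\<close>

lemma pmp_action_partial_iso: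
  assumes act: "pmp_action G M \<alpha>" and g: "g \<in> carrier G" and A: "A \<in> sets M"
  shows "partial_iso M A (\<alpha> g ` A) (\<alpha> g)"
proof -
  note act_simps = pmp_action_facts[OF act]
  interpret group G using act_simps(7)[OF g] .
  have ig: "inv\<^bsub>G\<^esub> g \<in> carrier G" using g by simp
  have Asp: "A \<subseteq> space M" using A by (rule sets.sets_into_space)
  have inv1: "\<alpha> (inv\<^bsub>G\<^esub> g) (\<alpha> g x) = x" if "x \<in> space M" for x
    using act_simps(4)[OF g that] .
  have inv2: "\<alpha> g (\<alpha> (inv\<^bsub>G\<^esub> g) x) = x" if "x \<in> space M" for x
    using act_simps(4)[OF ig that] g by simp
  have im: "\<alpha> g ` C = \<alpha> (inv\<^bsub>G\<^esub> g) -` C \<inter> space M" if "C \<subseteq> space M" for C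
    using that inv1 inv2 act_simps(3)[OF g] by (auto intro!: image_eqI)
  have meas: "\<alpha> g \<in> measurable M M" "\<alpha> (inv\<^bsub>G\<^esub> g) \<in> measurable M M"
    using act_simps(1) g ig by auto
  have B: "\<alpha> g ` A \<in> sets M"
    unfolding im[OF Asp] using meas(2) A by (rule measurable_sets)
  have inj: "inj_on (\<alpha> g) A"
    using inv1 Asp by (intro inj_on_inverseI[of _ "\<alpha> (inv\<^bsub>G\<^esub> g)"]) auto
  have Bsp: "\<alpha> g ` A \<subseteq> space M" using B by (rule sets.sets_into_space)
  have f: "\<alpha> g \<in> measurable (restrict_space M A) (restrict_space M (\<alpha> g ` A))"
    using meas(1) by (intro measurable_restrict_space3) auto
  have "the_inv_into A (\<alpha> g) \<in> measurable (restrict_space M (\<alpha> g ` A)) (restrict_space M A)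
    \<longleftrightarrow> \<alpha> (inv\<^bsub>G\<^esub> g) \<in> measurable (restrict_space M (\<alpha> g ` A)) (restrict_space M A)"
    using Asp inv1 the_inv_into_f_f[OF inj]
    by (intro measurable_cong) (auto simp: space_restrict_space subset_eq)
  also have "\<dots>"
    using meas(2) inv1 Asp by (intro measurable_restrict_space3) auto
  finally have g': "the_inv_into A (\<alpha> g) \<in> measurable (restrict_space M (\<alpha> g ` A)) (restrict_space M A)" .
  have "distr (restrict_space M A) (restrict_space M (\<alpha> g ` A)) (\<alpha> g) = restrict_space M (\<alpha> g ` A)"
  proof (rule measure_eqI)
    fix C assume "C \<in> sets (distr (restrict_space M A) (restrict_space M (\<alpha> g ` A)) (\<alpha> g))"
    then have C': "C \<in> sets (restrict_space M (\<alpha> g ` A))" by simp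
    then have C: "C \<in> sets M" "C \<subseteq> \<alpha> g ` A" using B by (auto simp: sets_restrict_space_iff)
    have eq: "\<alpha> g -` C \<inter> space M = \<alpha> g -` C \<inter> space (restrict_space M A)"
    proof -
      have "x \<in> A" if x: "x \<in> space M" "\<alpha> g x \<in> C" for x
      proof -
        obtain a where a: "a \<in> A" "\<alpha> g x = \<alpha> g a" using C(2) x(2) by blast
        then have "x = a" using inv1[OF x(1)] inv1[of a] Asp by auto
        then show ?thesis using a(1) by simp
      qed
      then show ?thesis using Asp by (auto simp: space_restrict_space)
    qed
    have "emeasure (distr (restrict_space M A) (restrict_space M (\<alpha> g ` A)) (\<alpha> g)) C
        = emeasure (restrict_space M A) (\<alpha> g -` C \<inter> space (restrict_space M A))"
      by (rule emeasure_distr[OF f C'])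
    also have "\<dots> = emeasure M (\<alpha> g -` C \<inter> space M)"
      unfolding eq using A Asp by (intro emeasure_restrict_space) (auto simp: space_restrict_space)
    also have "\<dots> = emeasure (distr M M (\<alpha> g)) C"
      by (rule emeasure_distr[OF meas(1) C(1), symmetric])
    also have "\<dots> = emeasure (restrict_space M (\<alpha> g ` A)) C"
      unfolding act_simps(2)[OF g] using B C by (subst emeasure_restrict_space) auto
    finally show "emeasure (distr (restrict_space M A) (restrict_space M (\<alpha> g ` A)) (\<alpha> g)) C
        = emeasure (restrict_space M (\<alpha> g ` A)) C" .
  qed simp
  then show ?thesis
    unfolding partial_iso_def using A B inj f g' by (auto simp: bij_betw_def)
qed

text \<open>To bound the cost from above it suffices to give finitely many group elements with domains on
  which to apply them. The edges stay inside orbits automatically, so only connectedness of the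
  orbits has to be checked.\<close>

lemma cost_orbit_relation_le:
  fixes J :: "'j set"
  assumes act: "pmp_action G M \<alpha>" and "finite J"
    and g: "\<And>j. j \<in> J \<Longrightarrow> g j \<in> carrier G" and A: "\<And>j. j \<in> J \<Longrightarrow> A j \<in> sets M"
    and conn: "\<And>E \<gamma> x. E = {(x, \<alpha> (g j) x) | j x. j \<in> J \<and> x \<in> A j} \<Longrightarrow> \<gamma> \<in> carrier G \<Longrightarrow>
      x \<in> space M \<Longrightarrow> (x, \<alpha> \<gamma> x) \<in> (E \<union> E\<inverse>)\<^sup>*"
  shows "cost M (orbit_relation G M \<alpha>) \<le> (\<Sum>j\<in>J. emeasure M (A j))"
proof -
  interpret group_action G "space M" \<alpha> using act by (simp add: pmp_action_def)
  obtain e where e: "bij_betw e {..<card J} J"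
    using ex_bij_betw_nat_finite[OF \<open>finite J\<close>] by (auto simp: atLeast0LessThan)
  let ?I = "{..<card J}" and ?R = "orbit_relation G M \<alpha>"
  let ?A = "\<lambda>i. A (e i)" and ?f = "\<lambda>i. \<alpha> (g (e i))" and ?B = "\<lambda>i. \<alpha> (g (e i)) ` A (e i)"
  have eJ: "e i \<in> J" if "i \<in> ?I" for i using e that by (auto simp: bij_betw_def)
  have sub: "x \<in> space M" if "x \<in> A j" "j \<in> J" for x j
    using sets.sets_into_space[OF A] that by blast
  have R: "(x, \<alpha> h x) \<in> ?R" if "x \<in> space M" "h \<in> carrier G" for x h
    using that by (auto simp: orbit_relation_def orbit_def)
  have gr: "graphing M ?R ?I ?A ?B ?f"
    unfolding graphing_def using pmp_action_partial_iso[OF act g A] eJ R sub g by blast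
  define E where "E = graphing_edges ?I ?A ?f"
  have E_eq: "E = {(x, \<alpha> (g j) x) | j x. j \<in> J \<and> x \<in> A j}"
  proof -
    have "E = {(x, \<alpha> (g j) x) | j x. j \<in> e ` ?I \<and> x \<in> A j}"
      unfolding E_def graphing_edges_def by blast
    then show ?thesis using e by (simp add: bij_betw_def)
  qed
  have ER: "(x, y) \<in> E \<union> E\<inverse> \<Longrightarrow> x \<in> space M \<and> y \<in> space M \<and> y \<in> orbit G \<alpha> x" for x y
  proof -
    have *: "x \<in> space M \<and> y \<in> space M \<and> y \<in> orbit G \<alpha> x" if "(x, y) \<in> E" for x y
      using that sub g element_image unfolding E_eq by (fastforce simp: orbit_def)
    assume "(x, y) \<in> E \<union> E\<inverse>"
    then show ?thesis using * orbit_sym by blast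
  qed
  have "graph_component E x = ?R `` {x}" if x: "x \<in> space M" for x
  proof
    show "graph_component E x \<subseteq> ?R `` {x}"
    proof
      fix y assume "y \<in> graph_component E x"
      then have "(x, y) \<in> (E \<union> E\<inverse>)\<^sup>*" by (simp add: graph_component_def)
      then have "y \<in> space M \<and> y \<in> orbit G \<alpha> x"
      proof induction
        case base
        then show ?case using x orbit_refl by blast
      next
        case (step y z)
        then show ?case using ER orbit_trans x by blast
      qed
      then show "y \<in> ?R `` {x}" using x by (simp add: orbit_relation_def)
    qed
    show "?R `` {x} \<subseteq> graph_component E x"
      using conn[OF E_eq] x by (auto simp: orbit_relation_def orbit_def graph_component_def)
  qed
  then have "generates M ?R ?I ?A ?f"
    unfolding generates_def E_def by (intro AE_I2)
  then have "cost M ?R \<le> graphing_cost M ?I ?A"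
    unfolding cost_def using gr by (intro Inf_lower) blast
  also have "\<dots> = (\<Sum>i\<in>?I. emeasure M (A (e i)))"
    by (simp add: graphing_cost_def)
  also have "\<dots> = (\<Sum>j\<in>J. emeasure M (A j))"
    using e by (rule sum.reindex_bij_betw)
  finally show ?thesis .
qed

section \<open>Cost and finite subgroups\<close>

lemma (in group) conjugate_subgroup_iff:
  assumes "subgroup K G" "s \<in> carrier G"
  shows "h \<in> s <# K #> inv s \<longleftrightarrow> h \<in> carrier G \<and> inv s \<otimes> h \<otimes> s \<in> K"
proof
  assume "h \<in> s <# K #> inv s"
  then obtain k where k: "k \<in> K" "h = s \<otimes> k \<otimes> inv s"
    by (auto simp: l_coset_def r_coset_def)
  have kc: "k \<in> carrier G" using assms(1) k(1) by (rule subgroup.mem_carrier)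
  have "inv s \<otimes> h \<otimes> s = k"
    using assms(2) kc unfolding k(2) by (simp add: m_assoc inv_solve_left')
  then show "h \<in> carrier G \<and> inv s \<otimes> h \<otimes> s \<in> K"
    using k kc assms(2) by simp
next
  assume h: "h \<in> carrier G \<and> inv s \<otimes> h \<otimes> s \<in> K"
  have "h = s \<otimes> (inv s \<otimes> h \<otimes> s) \<otimes> inv s"
    using assms(2) h by (simp flip: m_assoc) (simp add: m_assoc)
  then show "h \<in> s <# K #> inv s"
    unfolding l_coset_def r_coset_def using h by blast
qed

lemma (in group) countable_generate:
  assumes "countable S" "S \<subseteq> carrier G"
  shows "countable (generate G S)"
proof -
  let ?w = "\<lambda>xs. foldr (\<otimes>) xs \<one>"
  let ?L = "lists (S \<union> (\<lambda>s. inv s) ` S)"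
  have closed: "?w xs \<in> carrier G" if "xs \<in> ?L" for xs
    using that assms(2) by (induction xs) auto
  have app: "?w (xs @ ys) = ?w xs \<otimes> ?w ys" if "xs \<in> ?L" "ys \<in> ?L" for xs ys
    using that(1)
  proof induction
    case Nil
    then show ?case using closed[OF that(2)] by simp
  next
    case (Cons x xs)
    then have "x \<in> carrier G" using assms(2) by auto
    then show ?case using Cons closed that(2) by (simp add: m_assoc)
  qed
  have "x \<in> ?w ` ?L" if "x \<in> generate G S" for x
    using that
  proof induction
    case one
    show ?case by (rule image_eqI[of _ _ "[]"]) auto
  next
    case (incl h)
    then show ?case using assms(2) by (intro image_eqI[of _ _ "[h]"]) auto
  next
    case (inv h)
    then show ?case using assms(2) by (intro image_eqI[of _ _ "[inv h]"]) auto
  next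
    case (eng h1 h2)
    then obtain xs ys where "xs \<in> ?L" "ys \<in> ?L" "h1 = ?w xs" "h2 = ?w ys" by blast
    then show ?case using app by (intro image_eqI[of _ _ "xs @ ys"]) auto
  qed
  then have "generate G S \<subseteq> ?w ` ?L" by blast
  moreover have "countable (?w ` ?L)" using assms(1) by simp
  ultimately show ?thesis by (rule countable_subset)
qed

text \<open>The graphing applies the elements of \<open>K\<close> other than the identity on a section \<open>Y\<close> of \<open>K\<close>, and
  each \<open>s\<^sup>-\<^sup>1\<close> with \<open>s \<in> S\<close> on a section \<open>Z s\<close> of the intersection of \<open>K\<close> with \<open>s K s\<^sup>-\<^sup>1\<close>. Within a
  \<open>K\<close>-orbit every point is joined to every other through a point of \<open>Y\<close>; the intersection elements
  move any \<open>x\<close> into \<open>Z s\<close>, and \<open>s\<^sup>-\<^sup>1\<close> carries this move to a move within a \<open>K\<close>-orbit.\<close>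

lemma cost_le_of_large_conjugate_intersections:
  fixes G :: "('g, 'b) monoid_scheme" (structure) and M :: "'x measure"
  assumes std: "standard_prob_space M" and act: "pmp_action G M \<alpha>"
    and free: "essentially_free G M \<alpha>"
    and S: "S \<subseteq> carrier G" "finite S" "generate G S = carrier G"
    and K: "subgroup K G" "finite K"
    and m: "m > 0" "\<And>s. s \<in> S \<Longrightarrow> m \<le> card (K \<inter> (s <# K #> inv s))"
  shows "cost M (orbit_relation G M \<alpha>) \<le> 1 + ennreal (card S / m)"
proof -
  note act_simps = pmp_action_facts[OF act]
  interpret group G
    using act_simps(7)[OF subgroup.mem_carrier[OF K(1) subgroup.one_closed[OF K(1)]]] .
  have Kc: "k \<in> carrier G" if "k \<in> K" for k using K(1) that by (rule subgroup.mem_carrier)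
  let ?H = "\<lambda>s. K \<inter> (s <# K #> inv s)"
  obtain Y where Y: "Y \<in> sets M" "\<And>x. x \<in> space M \<Longrightarrow> \<exists>h\<in>K. \<alpha> h x \<in> Y"
    "of_nat (card K) * emeasure M Y \<le> 1"
    using finite_subgroup_small_section[OF std act free K] by metis
  have "\<exists>Z. Z \<in> sets M \<and> (\<forall>x\<in>space M. \<exists>h\<in>?H s. \<alpha> h x \<in> Z)
      \<and> of_nat (card (?H s)) * emeasure M Z \<le> 1" if "s \<in> S" for s
  proof -
    have "subgroup (?H s) G"
      using subgroups_Inter_pair[OF K(1) subgroup_conjugation_is_surj2[OF _ K(1)]] S(1) that by blast
    then show ?thesis
      using finite_subgroup_small_section[OF std act free] K(2) by (metis finite_Int)
  qed
  then obtain Z where Z: "\<And>s. s \<in> S \<Longrightarrow> Z s \<in> sets M"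
      "\<And>s x. s \<in> S \<Longrightarrow> x \<in> space M \<Longrightarrow> \<exists>h\<in>?H s. \<alpha> h x \<in> Z s"
      "\<And>s. s \<in> S \<Longrightarrow> of_nat (card (?H s)) * emeasure M (Z s) \<le> 1"
    by metis
  define J where "J = (K - {\<one>}) <+> S"
  define g where "g = case_sum (\<lambda>k. k) (\<lambda>s. inv s)"
  define A where "A = case_sum (\<lambda>_ :: 'g. Y) Z"
  have "cost M (orbit_relation G M \<alpha>) \<le> (\<Sum>j\<in>J. emeasure M (A j))"
  proof (rule cost_orbit_relation_le[OF act])
    show "finite J" using K(2) S(2) by (simp add: J_def)
    show "g j \<in> carrier G" "A j \<in> sets M" if "j \<in> J" for j
      using that Kc S(1) Y(1) Z(1) by (auto simp: J_def g_def A_def)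
    fix E \<gamma> x
    assume E: "E = {(x, \<alpha> (g j) x) | j x. j \<in> J \<and> x \<in> A j}"
      and \<gamma>: "\<gamma> \<in> carrier G" and x: "x \<in> space M"
    let ?C = "(E \<union> E\<inverse>)\<^sup>*"
    have C_sym: "(b, a) \<in> ?C" if "(a, b) \<in> ?C" for a b
    proof -
      have "sym ?C" by (intro sym_rtrancl sym_Un_converse)
      then show ?thesis using that by (rule symD)
    qed
    have Y_edge: "(y, \<alpha> k y) \<in> ?C" if "y \<in> Y" "k \<in> K" for y k
    proof (cases "k = \<one>")
      case True
      have "y \<in> space M" using that(1) Y(1) sets.sets_into_space by blast
      then show ?thesis using True act_simps(6)[OF one_closed] by simp
    next
      case False
      then have "Inl k \<in> J" "y \<in> A (Inl k)" "g (Inl k) = k"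
        using that by (auto simp: J_def A_def g_def)
      then have "(y, \<alpha> k y) \<in> E" unfolding E by force
      then show ?thesis by blast
    qed
    have K_conn: "(y, \<alpha> k y) \<in> ?C" if y: "y \<in> space M" and k: "k \<in> K" for y k
    proof -
      obtain h where h: "h \<in> K" "\<alpha> h y \<in> Y" using Y(2)[OF y] by blast
      have "k \<otimes> inv h \<in> K" "inv h \<in> K"
        using h k K(1) by (auto simp: subgroup.m_closed subgroup.m_inv_closed)
      then have "(\<alpha> h y, \<alpha> (k \<otimes> inv h) (\<alpha> h y)) \<in> ?C" "(\<alpha> h y, \<alpha> (inv h) (\<alpha> h y)) \<in> ?C"
        using Y_edge h(2) by blast+
      moreover have "\<alpha> (k \<otimes> inv h) (\<alpha> h y) = \<alpha> k y" "\<alpha> (inv h) (\<alpha> h y) = y"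
        using h k Kc y by (simp_all add: act_simps(3,4,5))
      ultimately show ?thesis using C_sym by (metis rtrancl_trans)
    qed
    \<comment> \<open>The path is \<open>y\<close>, \<open>h y\<close>, \<open>s\<^sup>-\<^sup>1 h y\<close>, \<open>s\<^sup>-\<^sup>1 y\<close>: a move in a \<open>K\<close>-orbit, an edge starting in \<open>Z s\<close>,
      and a move in a \<open>K\<close>-orbit by an element inverse to \<open>s\<^sup>-\<^sup>1 h s\<close>.\<close>
    have inv_conn: "(y, \<alpha> (inv s) y) \<in> ?C" if s: "s \<in> S" and y: "y \<in> space M" for s y
    proof -
      have sc: "s \<in> carrier G" using s S(1) by blast
      obtain h where h: "h \<in> ?H s" "\<alpha> h y \<in> Z s" using Z(2)[OF s y] by blast
      have hK: "h \<in> K" "h \<in> carrier G" and conj: "inv s \<otimes> h \<otimes> s \<in> K"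
        using h(1) conjugate_subgroup_iff[OF K(1) sc] by auto
      have "(y, \<alpha> h y) \<in> ?C" using K_conn y hK(1) by blast
      moreover have "(\<alpha> h y, \<alpha> (inv s) (\<alpha> h y)) \<in> ?C"
      proof -
        have "Inr s \<in> J" "\<alpha> h y \<in> A (Inr s)" "g (Inr s) = inv s"
          using s h by (auto simp: J_def A_def g_def)
        then have "(\<alpha> h y, \<alpha> (inv s) (\<alpha> h y)) \<in> E" unfolding E by force
        then show ?thesis by blast
      qed
      moreover have "(\<alpha> (inv s) y, \<alpha> (inv s) (\<alpha> h y)) \<in> ?C"
      proof -
        have "\<alpha> (inv s \<otimes> h \<otimes> s) (\<alpha> (inv s) y) = \<alpha> (inv s \<otimes> h \<otimes> s \<otimes> inv s) y"
          using sc hK y by (intro act_simps(5)[symmetric]) auto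
        also have "inv s \<otimes> h \<otimes> s \<otimes> inv s = inv s \<otimes> h"
          using sc hK by (simp add: m_assoc)
        also have "\<alpha> (inv s \<otimes> h) y = \<alpha> (inv s) (\<alpha> h y)"
          using sc hK y by (intro act_simps(5)) auto
        finally show ?thesis
          using K_conn[of "\<alpha> (inv s) y", OF _ conj] sc y by (simp add: act_simps(3))
      qed
      ultimately show ?thesis using C_sym by (metis rtrancl_trans)
    qed
    have "\<gamma> \<in> generate G S" using \<gamma> S(3) by simp
    then show "(x, \<alpha> \<gamma> x) \<in> ?C"
      using x
    proof (induction arbitrary: x)
      case one
      then show ?case by (simp add: act_simps(6)[OF one_closed])
    next
      case (inv s)
      then show ?case using inv_conn by blast
    next
      case (incl s)
      then have "s \<in> carrier G" using S(1) by blast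
      then show ?case
        using inv_conn[of s "\<alpha> s x"] incl C_sym by (simp add: act_simps(3,4))
    next
      case (eng g h)
      then have "g \<in> carrier G" "h \<in> carrier G" using S(3) by auto
      then show ?case
        using eng by (metis act_simps(3,5) rtrancl_trans)
    qed
  qed
  also have "\<dots> = (\<Sum>k\<in>K - {\<one>}. emeasure M Y) + (\<Sum>s\<in>S. emeasure M (Z s))"
    unfolding J_def A_def using K(2) S(2) by (subst sum.Plus) auto
  also have "\<dots> \<le> 1 + ennreal (card S / m)"
  proof (rule add_mono)
    have "(\<Sum>k\<in>K - {\<one>}. emeasure M Y) \<le> (\<Sum>k\<in>K. emeasure M Y)"
      using K(2) by (intro sum_mono2) auto
    also have "\<dots> \<le> 1" using Y(3) by simp
    finally show "(\<Sum>k\<in>K - {\<one>}. emeasure M Y) \<le> 1" .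
    have "emeasure M (Z s) \<le> ennreal (1 / m)" if s: "s \<in> S" for s
    proof -
      have "of_nat m * emeasure M (Z s) \<le> of_nat (card (?H s)) * emeasure M (Z s)"
        using m(2)[OF s] by (intro mult_right_mono) auto
      also have "\<dots> \<le> 1" using Z(3)[OF s] .
      finally have le: "of_nat m * emeasure M (Z s) \<le> 1" .
      have "emeasure M (Z s) = ennreal (1 / m) * (of_nat m * emeasure M (Z s))"
        using m(1) by (simp add: mult.assoc[symmetric] ennreal_of_nat_eq_real_of_nat
            ennreal_mult[symmetric])
      also have "\<dots> \<le> ennreal (1 / m) * 1"
        using le by (rule mult_left_mono) simp
      finally show ?thesis by simp
    qed
    then have "(\<Sum>s\<in>S. emeasure M (Z s)) \<le> (\<Sum>s\<in>S. ennreal (1 / m))"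
      by (rule sum_mono)
    also have "\<dots> = ennreal (card S / m)"
      by (subst sum_ennreal) auto
    finally show "(\<Sum>s\<in>S. emeasure M (Z s)) \<le> ennreal (card S / m)" .
  qed
  finally show ?thesis .
qed

text \<open>A section of \<open>H\<close> meets every \<open>H\<close>-orbit and hence every orbit of the whole group, so it can serve
  as the set towards which edges are directed in \<open>one_le_measure_plus_graphing_cost\<close>.\<close>

lemma one_le_cost_plus_inverse_card:
  assumes std: "standard_prob_space M" and act: "pmp_action G M \<alpha>"
    and free: "essentially_free G M \<alpha>" and H: "subgroup H G" "finite H"
  shows "1 \<le> cost M (orbit_relation G M \<alpha>) + ennreal (1 / card H)"
proof -
  interpret prob_space M using std by (simp add: standard_prob_space_def)
  obtain Y where Y: "Y \<in> sets M" "\<And>x. x \<in> space M \<Longrightarrow> \<exists>h\<in>H. \<alpha> h x \<in> Y"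
    "of_nat (card H) * emeasure M Y \<le> 1"
    using finite_subgroup_small_section[OF std act free H] by metis
  have "card H > 0" using H subgroup.one_closed card_gt_0_iff by blast
  then have "emeasure M Y \<le> ennreal (1 / card H)"
  proof -
    have "real (card H) * measure M Y \<le> 1"
      using Y(3) by (simp add: emeasure_eq_measure ennreal_of_nat_eq_real_of_nat
          ennreal_mult[symmetric])
    then show ?thesis using \<open>card H > 0\<close>
      by (simp add: emeasure_eq_measure field_simps)
  qed
  moreover have "1 - emeasure M Y \<le> cost M (orbit_relation G M \<alpha>)"
    unfolding cost_def
  proof (rule Inf_greatest, clarify)
    fix I A B f
    assume gr: "graphing M (orbit_relation G M \<alpha>) I A B f"
      and gen: "generates M (orbit_relation G M \<alpha>) I A f"
    have "AE x in M. orbit_relation G M \<alpha> `` {x} \<inter> Y \<noteq> {}"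
      using Y(2) subgroup.mem_carrier[OF H(1)]
      by (intro AE_I2) (fastforce simp: orbit_relation_def orbit_def)
    then have "1 \<le> emeasure M Y + graphing_cost M I A"
      by (intro one_le_measure_plus_graphing_cost[OF _ gr gen Y(1)]) unfold_locales
    then show "1 - emeasure M Y \<le> graphing_cost M I A"
      by (simp add: ennreal_minus_le_iff)
  qed
  then have "1 \<le> emeasure M Y + cost M (orbit_relation G M \<alpha>)"
    by (simp add: ennreal_minus_le_iff)
  ultimately show ?thesis
    by (metis add.commute add_left_mono order_trans)
qed

theorem corollary2p5:
  fixes \<Gamma> :: "('g, 'b) monoid_scheme" (structure)
    and S :: "'g set" and K :: "nat \<Rightarrow> 'g set"
  assumes "group \<Gamma>" and "infinite (carrier \<Gamma>)"
    and "S \<subseteq> carrier \<Gamma>" and "finite S" and "S = set_inv\<^bsub>\<Gamma>\<^esub> S" and "\<one>\<^bsub>\<Gamma>\<^esub> \<in> S"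
    and "generate \<Gamma> S = carrier \<Gamma>"
    and "\<And>n. subgroup (K n) \<Gamma>" and "\<And>n. finite (K n)"
    and "filterlim
           (\<lambda>n. Min ((\<lambda>s. card (K n \<inter> (s <#\<^bsub>\<Gamma>\<^esub> K n #>\<^bsub>\<Gamma>\<^esub> inv\<^bsub>\<Gamma>\<^esub> s))) ` S)) at_top sequentially"
  shows "fixed_price_one TYPE('x) \<Gamma>"
  unfolding fixed_price_one_def
proof (intro conjI allI impI)
  interpret group \<Gamma> by fact
  show "group \<Gamma>" by fact
  show "countable (carrier \<Gamma>)"
    using countable_generate[OF countable_finite[OF \<open>finite S\<close>] \<open>S \<subseteq> carrier \<Gamma>\<close>] assms(7) by simp
  fix M :: "'x measure" and \<alpha>
  assume "standard_prob_space M \<and> pmp_action \<Gamma> M \<alpha> \<and> essentially_free \<Gamma> M \<alpha>"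
  then have std: "standard_prob_space M" and act: "pmp_action \<Gamma> M \<alpha>"
    and free: "essentially_free \<Gamma> M \<alpha>" by auto
  let ?H = "\<lambda>n s. K n \<inter> (s <# K n #> inv s)"
  have large: "\<exists>n. \<forall>s\<in>S. m \<le> card (?H n s)" for m
  proof -
    obtain n where "m \<le> Min ((\<lambda>s. card (?H n s)) ` S)"
      using assms(10) unfolding filterlim_at_top eventually_sequentially by blast
    then show ?thesis using \<open>finite S\<close> \<open>\<one> \<in> S\<close> by (subst (asm) Min_ge_iff) auto
  qed
  show "cost M (orbit_relation \<Gamma> M \<alpha>) = 1"
  proof (rule antisym)
    show "cost M (orbit_relation \<Gamma> M \<alpha>) \<le> 1"
    proof (rule ennreal_le_epsilon)
      fix e :: real assume "0 < e"
      obtain m :: nat where m: "m > card S / e" using reals_Archimedean2 by blast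
      then have "m > 0" using \<open>0 < e\<close> by (cases m) (auto simp: field_simps)
      obtain n where "\<And>s. s \<in> S \<Longrightarrow> m \<le> card (?H n s)" using large by blast
      then have "cost M (orbit_relation \<Gamma> M \<alpha>) \<le> 1 + ennreal (card S / m)"
        by (rule cost_le_of_large_conjugate_intersections[OF std act free assms(3,4,7,8,9) \<open>m > 0\<close>])
      also have "\<dots> \<le> 1 + ennreal e"
        using m \<open>0 < e\<close> \<open>m > 0\<close> by (intro add_left_mono ennreal_leI) (simp add: field_simps)
      finally show "cost M (orbit_relation \<Gamma> M \<alpha>) \<le> 1 + ennreal e" .
    qed
    show "1 \<le> cost M (orbit_relation \<Gamma> M \<alpha>)"
    proof (rule ennreal_le_epsilon)
      fix e :: real assume "0 < e"
      obtain m :: nat where m: "m > 1 / e" using reals_Archimedean2 by blast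
      obtain n where n: "m \<le> card (?H n \<one>)" using large \<open>\<one> \<in> S\<close> by blast
      also have "\<dots> \<le> card (K n)" using assms(9) by (intro card_mono) auto
      finally have "1 / e < card (K n)" using m by linarith
      moreover from this have "0 < real (card (K n))"
        using \<open>0 < e\<close> by (metis less_trans zero_less_divide_1_iff)
      ultimately have "1 / real (card (K n)) \<le> e"
        using \<open>0 < e\<close> by (simp add: field_simps)
      then show "1 \<le> cost M (orbit_relation \<Gamma> M \<alpha>) + ennreal e"
        using one_le_cost_plus_inverse_card[OF std act free assms(8,9), of n]
        by (meson add_left_mono ennreal_leI order_trans)
    qed
  qed
qed

end
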